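(* Let $A$ be an abelian group. Suppose there are a nonprincipal ultrafilter $\mathcal{U}$ on $\omega$ and groups $(G_i)_{i\in\omega}$, not necessarily abelian, such that $A$ is a homomorphic image of the ultraproduct $(\prod_{i\in\omega} G_i)/\mathcal{U}$. Then there are a nonprincipal ultrafilter $\mathcal{V}$ on $\omega$ and abelian groups $(A_i)_{i\in\omega}$ such that $A$ is a homomorphic image of the ultraproduct $(\prod_{i\in\omega} A_i)/\mathcal{V}$.
   Context: $\omega$ is the set of natural numbers. For an ultrafilter $\mathcal{U}$ on $\omega$, the ultraproduct $(\prod_{i\in\omega} G_i)/\mathcal{U}$ is the quotient of the direct product $\prod_{i\in\omega} G_i$ by the normal subgroup of all $(g_i)_{i\in\omega}$ with $\{i\in\omega : g_i = 1_{G_i}\}\in\mathcal{U}$. "Homomorphic image" means image under a surjective group homomorphism. *)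

theory Defs
  imports "HOL-Algebra.Product_Groups"
begin

text \<open>A set \<open>X\<close> belongs to the filter \<open>F\<close> iff \<open>eventually (\<lambda>x. x \<in> X) F\<close>. The type
  of filters includes the improper filter \<open>bot\<close>, which is not an ultrafilter.\<close>

definition is_ultrafilter :: "'i filter \<Rightarrow> bool" where
  "is_ultrafilter F \<longleftrightarrow> F \<noteq> bot \<and> (\<forall>P. eventually P F \<or> eventually (\<lambda>x. \<not> P x) F)"

text \<open>The sets belonging to the library filter \<open>principal {x}\<close> are exactly those containing \<open>x\<close>.\<close>

definition nonprincipal_ultrafilter :: "'i filter \<Rightarrow> bool" where
  "nonprincipal_ultrafilter F \<longleftrightarrow> is_ultrafilter F \<and> (\<forall>x. F \<noteq> principal {x})"

definition ultra_kernel :: "'i filter \<Rightarrow> ('i \<Rightarrow> ('g, 'm) monoid_scheme) \<Rightarrow> ('i \<Rightarrow> 'g) set" where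
  "ultra_kernel F G =
     {g \<in> carrier (product_group UNIV G). eventually (\<lambda>i. g i = \<one>\<^bsub>G i\<^esub>) F}"

definition ultraproduct :: "'i filter \<Rightarrow> ('i \<Rightarrow> ('g, 'm) monoid_scheme) \<Rightarrow> ('i \<Rightarrow> 'g) set monoid" where
  "ultraproduct F G = product_group UNIV G Mod ultra_kernel F G"

lemma normal_ultra_kernel:
  assumes G: "\<And>i. group (G i)"
  shows "ultra_kernel F G \<lhd> product_group UNIV G"
proof -
  interpret P: group "product_group UNIV G"
    using G by simp
  have inv_P: "inv\<^bsub>product_group UNIV G\<^esub> x = (\<lambda>i. inv\<^bsub>G i\<^esub> x i)"
    if "x \<in> (\<Pi>\<^sub>E i\<in>UNIV. carrier (G i))" for x
    using inv_product_group[OF that] G by (simp add: fun_eq_iff)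
  have sub: "subgroup (ultra_kernel F G) (product_group UNIV G)"
  proof (rule P.subgroupI)
    show "ultra_kernel F G \<subseteq> carrier (product_group UNIV G)"
      by (auto simp: ultra_kernel_def)
    have "\<one>\<^bsub>product_group UNIV G\<^esub> \<in> ultra_kernel F G"
      using P.one_closed by (simp add: ultra_kernel_def)
    then show "ultra_kernel F G \<noteq> {}"
      by blast
  next
    fix a assume a: "a \<in> ultra_kernel F G"
    then have "inv\<^bsub>product_group UNIV G\<^esub> a \<in> carrier (product_group UNIV G)"
      by (intro P.inv_closed) (simp add: ultra_kernel_def)
    moreover have "eventually (\<lambda>i. inv\<^bsub>G i\<^esub> a i = \<one>\<^bsub>G i\<^esub>) F"
      using a G by (auto simp: ultra_kernel_def group.is_monoid monoid.inv_one monoid.l_one monoid.r_one elim!: eventually_mono)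
    ultimately show "inv\<^bsub>product_group UNIV G\<^esub> a \<in> ultra_kernel F G"
      using a inv_P[of a] by (simp add: ultra_kernel_def)
  next
    fix a b assume a: "a \<in> ultra_kernel F G" and b: "b \<in> ultra_kernel F G"
    then have "a \<otimes>\<^bsub>product_group UNIV G\<^esub> b \<in> carrier (product_group UNIV G)"
      by (intro P.m_closed) (simp_all add: ultra_kernel_def)
    moreover have "eventually (\<lambda>i. a i \<otimes>\<^bsub>G i\<^esub> b i = \<one>\<^bsub>G i\<^esub>) F"
    proof (rule eventually_elim2)
      show "eventually (\<lambda>i. a i = \<one>\<^bsub>G i\<^esub>) F" "eventually (\<lambda>i. b i = \<one>\<^bsub>G i\<^esub>) F"
        using a b by (simp_all add: ultra_kernel_def)
    qed (simp add: G group.is_monoid)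
    ultimately show "a \<otimes>\<^bsub>product_group UNIV G\<^esub> b \<in> ultra_kernel F G"
      by (simp add: ultra_kernel_def)
  qed
  show ?thesis
  proof (rule P.normal_invI[OF sub])
    fix x h
    assume x: "x \<in> carrier (product_group UNIV G)" and h: "h \<in> ultra_kernel F G"
    have "x \<otimes>\<^bsub>product_group UNIV G\<^esub> h \<otimes>\<^bsub>product_group UNIV G\<^esub> inv\<^bsub>product_group UNIV G\<^esub> x
        \<in> carrier (product_group UNIV G)"
      using x h by (intro P.m_closed P.inv_closed) (simp_all add: ultra_kernel_def)
    moreover have "eventually (\<lambda>i. x i \<otimes>\<^bsub>G i\<^esub> h i \<otimes>\<^bsub>G i\<^esub> inv\<^bsub>G i\<^esub> x i = \<one>\<^bsub>G i\<^esub>) F"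
      using x h G
      by (auto simp: ultra_kernel_def PiE_iff group.is_monoid monoid.r_one group.r_inv elim!: eventually_mono)
    ultimately show "x \<otimes>\<^bsub>product_group UNIV G\<^esub> h \<otimes>\<^bsub>product_group UNIV G\<^esub> inv\<^bsub>product_group UNIV G\<^esub> x
        \<in> ultra_kernel F G"
      using x inv_P[of x] by (simp add: ultra_kernel_def)
  qed
qed

text \<open>\<open>P\<close> and \<open>A\<close> are meant to be groups. In existence claims about families of groups the type
  of their elements has to be chosen. For an image \<open>A\<close> with elements of type \<open>'a\<close>, the type
  \<open>'a \<times> nat\<close> loses no generality: given groups \<open>H i\<close> of any size and a surjection from their
  ultraproduct onto \<open>A\<close>, lift each \<open>a\<close> in \<open>A\<close> to a sequence \<open>g a\<close>, and replace \<open>H i\<close> by its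
  subgroup generated by all \<open>g a i\<close>, whose cardinality is at most that of \<open>'a \<times> nat\<close>,
  so that it has an isomorphic copy there.\<close>

definition homomorphic_image_of :: "('a, 'm) monoid_scheme \<Rightarrow> ('b, 'n) monoid_scheme \<Rightarrow> bool" where
  "homomorphic_image_of A P \<longleftrightarrow> (\<exists>h. h \<in> epi P A)"

end

theory Submission
  imports Defs "HOL.Modules" "HOL-Algebra.Free_Abelian_Groups" "HOL-Library.Function_Algebras"
begin

text \<open>Given \<open>a\<^sub>n\<close> in \<open>A\<close> and integers \<open>q\<^sub>n\<close>, lift the \<open>a\<^sub>n\<close> to the product of the \<open>G\<^sub>i\<close>. In \<open>G\<^sub>i\<close> the
  equations \<open>x\<^sub>n = a\<^sub>n x\<^sub>n\<^sub>+\<^sub>1\<^bsup>q\<^sub>n\<^esup>\<close> with \<open>n \<le> i\<close> are solved backwards from \<open>x\<^sub>i\<^sub>+\<^sub>1 = 1\<close>, so all of them are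
  solvable in the ultraproduct, hence in \<open>A\<close>. This makes \<open>A\<close> cotorsion: homomorphisms into \<open>A\<close>
  extend along inclusions with torsion-free cokernel. Now let \<open>p\<close> map a free abelian group \<open>F\<close>
  onto \<open>A\<close>. The quotient of the ultrapower of \<open>F\<close> by the diagonal copy of \<open>F\<close> is torsion-free,
  so \<open>p\<close> extends to the ultrapower.\<close>

section \<open>Abelian groups as integer modules, and complements modulo a subgroup\<close>

locale int_module = Modules.module scale
  for scale :: "int \<Rightarrow> 'b::ab_group_add \<Rightarrow> 'b" (infixr "*s" 75)
begin

text \<open>For a subgroup \<open>S\<close> this says that the quotient by \<open>S\<close> is
  torsion-free, which in groups with torsion is stronger than purity in the usual sense.\<close>

definition pure_in :: "'b set \<Rightarrow> bool" where
  "pure_in S \<longleftrightarrow> (\<forall>n x. n \<noteq> 0 \<longrightarrow> n *s x \<in> S \<longrightarrow> x \<in> S)"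

lemma subspace_set_sum:
  assumes "subspace S" "subspace T"
  shows "subspace {x + y |x y. x \<in> S \<and> y \<in> T}"
proof (rule subspaceI)
  show "0 \<in> {x + y |x y. x \<in> S \<and> y \<in> T}"
    using assms by (force simp: subspace_0 intro: exI[of _ 0])
next
  fix a b assume "a \<in> {x + y |x y. x \<in> S \<and> y \<in> T}" "b \<in> {x + y |x y. x \<in> S \<and> y \<in> T}"
  then obtain x y x' y' where *: "a = x + y" "b = x' + y'" "x \<in> S" "x' \<in> S" "y \<in> T" "y' \<in> T"
    by blast
  have "a + b = (x + x') + (y + y')"
    by (simp add: *)
  with * assms show "a + b \<in> {x + y |x y. x \<in> S \<and> y \<in> T}"
    by (blast intro: subspace_add)
next
  fix c a assume "a \<in> {x + y |x y. x \<in> S \<and> y \<in> T}"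
  then show "c *s a \<in> {x + y |x y. x \<in> S \<and> y \<in> T}"
    using assms by (force simp: scale_right_distrib intro: subspace_scale)
qed

text \<open>Modulo \<open>S\<close>, multiplication by \<open>N\<close> is injective and sends the
  elements in question into the cyclic group generated by \<open>w\<close>. They therefore form a
  cyclic group, and \<open>u\<close> represents a generator: its \<open>N\<close>-fold is the least
  positive multiple of \<open>w\<close> that is divisible by \<open>N\<close> modulo
  \<open>S\<close>.\<close>

lemma cyclic_mod_pure:
  assumes S: "subspace S" "pure_in S" and N: "N > 0"
  shows "\<exists>u. \<forall>v. (\<exists>k. N *s v - k *s w \<in> S) \<longleftrightarrow> (\<exists>k. v - k *s u \<in> S)"
proof -
  define P where "P d \<longleftrightarrow> d > 0 \<and> (\<exists>v. N *s v - int d *s w \<in> S)" for d :: nat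
  have "N *s w - int (nat N) *s w \<in> S"
    using S N by (simp add: subspace_0)
  then have "P (nat N)"
    using N unfolding P_def by (auto intro: exI[of _ w])
  define d where "d = (LEAST d. P d)"
  have "P d"
    unfolding d_def by (rule LeastI) fact
  then obtain u where d: "d > 0" and u: "N *s u - int d *s w \<in> S"
    unfolding P_def by blast
  have "(\<exists>k. N *s v - k *s w \<in> S) \<longleftrightarrow> (\<exists>k. v - k *s u \<in> S)" for v
  proof
    assume "\<exists>k. N *s v - k *s w \<in> S"
    then obtain k where k: "N *s v - k *s w \<in> S" by blast
    define q r where "q = k div int d" and "r = k mod int d"
    have kqr: "k = q * int d + r"
      by (simp add: q_def r_def)
    have r: "0 \<le> r" "r < int d"
      using d by (simp_all add: r_def)
    have "N *s (v - q *s u) - r *s w = (N *s v - k *s w) - q *s (N *s u - int d *s w)"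
      by (simp add: kqr algebra_simps)
    then have *: "N *s (v - q *s u) - r *s w \<in> S"
      using S k u by (simp add: subspace_diff subspace_scale)
    have "r = 0"
    proof (rule ccontr)
      assume "r \<noteq> 0"
      with r * have "P (nat r)"
        unfolding P_def by (auto intro!: exI[of _ "v - q *s u"])
      then have "d \<le> nat r"
        unfolding d_def by (rule Least_le)
      with r show False by linarith
    qed
    with * have "N *s (v - q *s u) \<in> S" by simp
    then have "v - q *s u \<in> S"
      using S N unfolding pure_in_def by (metis less_irrefl)
    then show "\<exists>k. v - k *s u \<in> S" ..
  next
    assume "\<exists>k. v - k *s u \<in> S"
    then obtain k where k: "v - k *s u \<in> S" by blast
    have "N *s v - (k * int d) *s w = N *s (v - k *s u) + k *s (N *s u - int d *s w)"
      by (simp add: algebra_simps)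
    then have "N *s v - (k * int d) *s w \<in> S"
      using S k u by (simp add: subspace_add subspace_scale)
    then show "\<exists>k. N *s v - k *s w \<in> S" ..
  qed
  then show ?thesis by blast
qed

text \<open>The successor step of a Zorn argument. Adjoining \<open>w\<close> alone could create
  torsion in the quotient by \<open>D + V\<close>, so the whole pure closure of \<open>w\<close>
  modulo \<open>D + V\<close> is adjoined. Solvability of countable systems in \<open>V/K\<close>
  keeps the intersection with \<open>V\<close> equal to \<open>K\<close>.\<close>

lemma extend_partial_complement:
  assumes V: "subspace V" and D: "subspace D" and DV: "D \<inter> V = K"
    and pure: "pure_in {x + y |x y. x \<in> D \<and> y \<in> V}"
    and solvable: "\<And>(a :: nat \<Rightarrow> 'b) q. (\<And>n. a n \<in> V) \<Longrightarrow>
      \<exists>x. \<forall>n. x n \<in> V \<and> x n - q n *s x (Suc n) - a n \<in> K"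
    and w: "w \<notin> {x + y |x y. x \<in> D \<and> y \<in> V}"
  obtains D' where "subspace D'" "D \<subseteq> D'" "D' \<inter> V = K"
    "pure_in {x + y |x y. x \<in> D' \<and> y \<in> V}" "w \<in> {x + y |x y. x \<in> D' \<and> y \<in> V}"
proof -
  define S where "S = {x + y |x y. x \<in> D \<and> y \<in> V}"
  have S: "subspace S" "pure_in S" "w \<notin> S"
    using V D pure w by (auto simp: S_def intro: subspace_set_sum)
  have DS: "D \<subseteq> S" and VS: "V \<subseteq> S"
    unfolding S_def using subspace_0[OF V] subspace_0[OF D]
    by (auto intro: exI[of _ 0]) (metis add.right_neutral)
  \<comment> \<open>Factorials suffice as multipliers, because every nonzero integer divides one of
    them.\<close>
  have "\<forall>n. \<exists>u. \<forall>v. (\<exists>k. (fact n :: int) *s v - k *s w \<in> S) \<longleftrightarrow> (\<exists>k. v - k *s u \<in> S)"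
    using cyclic_mod_pure[OF S(1,2)] by simp
  then obtain u where u: "\<And>n v. (\<exists>k. (fact n :: int) *s v - k *s w \<in> S) \<longleftrightarrow> (\<exists>k. v - k *s u n \<in> S)"
    by metis
  \<comment> \<open>Modulo \<open>S\<close>, the pure closure of \<open>w\<close> is the union of the increasing chain of cyclic groups
    generated by the \<open>u n\<close>. Subtracting a solution \<open>x\<close> of a system in \<open>V\<close> turns the relations
    between consecutive \<open>u n\<close> modulo \<open>S\<close> into relations modulo \<open>D\<close>.\<close>
  have u_notin: "u n \<notin> S" for n
  proof
    assume un: "u n \<in> S"
    have "(fact n :: int) *s w - fact n *s w \<in> S"
      using S by (simp add: subspace_0)
    then obtain k where "w - k *s u n \<in> S" using u by metis
    then have "(w - k *s u n) + k *s u n \<in> S"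
      using S un by (intro subspace_add subspace_scale) auto
    with S show False by simp
  qed
  have "\<exists>q. u n - q *s u (Suc n) \<in> S" for n
  proof -
    have "u n - 1 *s u n \<in> S"
      using S by (simp add: subspace_0)
    then obtain k where "(fact n :: int) *s u n - k *s w \<in> S" using u by metis
    then have "int (Suc n) *s ((fact n :: int) *s u n - k *s w) \<in> S"
      by (rule subspace_scale[OF S(1)])
    then have "(fact (Suc n) :: int) *s u n - (int (Suc n) * k) *s w \<in> S"
      by (simp add: scale_right_diff_distrib)
    then show ?thesis using u by metis
  qed
  then have "\<exists>q g v. g \<in> D \<and> v \<in> V \<and> u n - q *s u (Suc n) = g + v" for n
    unfolding S_def by blast
  then obtain q g v where gv: "\<And>n. g n \<in> D" "\<And>n. v n \<in> V" "\<And>n. u n - q n *s u (Suc n) = g n + v n"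
    by metis
  obtain x where x: "\<And>n. x n \<in> V" "\<And>n. x n - q n *s x (Suc n) - v n \<in> K"
    using solvable[of v q] gv(2) by metis
  define y where "y n = u n - x n" for n
  have y_step: "y n - q n *s y (Suc n) \<in> D" for n
  proof -
    have "y n - q n *s y (Suc n) = (u n - q n *s u (Suc n)) - v n - (x n - q n *s x (Suc n) - v n)"
      by (simp add: y_def algebra_simps)
    also have "\<dots> = g n - (x n - q n *s x (Suc n) - v n)"
      by (simp add: gv(3))
    finally show ?thesis
      using gv(1)[of n] x(2)[of n] DV D by (auto intro: subspace_diff)
  qed
  \<comment> \<open>By \<open>y_step\<close> these subgroups increase with \<open>n\<close>, so
    their union is again a subgroup.\<close>
  define L where "L n = {z. \<exists>k. z - k *s y n \<in> D}" for n
  have L_add: "a + b \<in> L n" if ab: "a \<in> L n" "b \<in> L n" for a b n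
  proof -
    obtain k l where "a - k *s y n \<in> D" "b - l *s y n \<in> D" using ab by (auto simp: L_def)
    then have "(a - k *s y n) + (b - l *s y n) \<in> D" by (rule subspace_add[OF D])
    then have "(a + b) - (k + l) *s y n \<in> D" by (simp add: algebra_simps)
    then show ?thesis unfolding L_def by blast
  qed
  have L_scale: "c *s a \<in> L n" if a: "a \<in> L n" for a c n
  proof -
    obtain k where "a - k *s y n \<in> D" using a by (auto simp: L_def)
    then have "c *s (a - k *s y n) \<in> D" by (rule subspace_scale[OF D])
    then have "c *s a - (c * k) *s y n \<in> D" by (simp add: algebra_simps)
    then show ?thesis unfolding L_def by blast
  qed
  have L_Suc: "L n \<subseteq> L (Suc n)" for n
  proof
    fix a assume "a \<in> L n"
    then obtain k where "a - k *s y n \<in> D" by (auto simp: L_def)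
    then have "(a - k *s y n) + k *s (y n - q n *s y (Suc n)) \<in> D"
      using y_step D by (intro subspace_add subspace_scale) auto
    then have "a - (k * q n) *s y (Suc n) \<in> D" by (simp add: algebra_simps)
    then show "a \<in> L (Suc n)" unfolding L_def by blast
  qed
  have L_mono: "L m \<subseteq> L n" if "m \<le> n" for m n
    using lift_Suc_mono_le[of L, OF L_Suc that] .
  have D_L: "D \<subseteq> L n" for n
  proof
    fix a assume "a \<in> D"
    then have "a - 0 *s y n \<in> D" by simp
    then show "a \<in> L n" unfolding L_def by blast
  qed
  have y_L: "y n \<in> L n" for n
  proof -
    have "y n - 1 *s y n \<in> D" using D by (simp add: subspace_0)
    then show ?thesis unfolding L_def by blast
  qed
  define D' where "D' = (\<Union>n. L n)"
  have sub: "subspace D'"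
  proof (rule subspaceI)
    show "0 \<in> D'" using D_L subspace_0[OF D] unfolding D'_def by blast
    show "c *s a \<in> D'" if "a \<in> D'" for c a
      using that L_scale unfolding D'_def by blast
    show "a + b \<in> D'" if ab: "a \<in> D'" "b \<in> D'" for a b
    proof -
      obtain m n where "a \<in> L m" "b \<in> L n" using ab unfolding D'_def by blast
      then have "a \<in> L (max m n)" "b \<in> L (max m n)"
        using L_mono[of m "max m n"] L_mono[of n "max m n"] by auto
      then show ?thesis using L_add unfolding D'_def by blast
    qed
  qed
  have DD': "D \<subseteq> D'" using D_L unfolding D'_def by blast
  \<comment> \<open>Since \<open>y n\<close> and \<open>u n\<close> differ by \<open>x n\<close>,
    which lies in \<open>V\<close>, adding \<open>V\<close> to the new subgroup gives exactly the
    pure closure of \<open>w\<close> modulo \<open>S\<close>.\<close>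
  have sums_iff: "z \<in> {x + y |x y. x \<in> D' \<and> y \<in> V} \<longleftrightarrow> (\<exists>n k. z - k *s u n \<in> S)" for z
  proof
    assume "z \<in> {x + y |x y. x \<in> D' \<and> y \<in> V}"
    then obtain a b n where ab: "a \<in> L n" "b \<in> V" "z = a + b" unfolding D'_def by blast
    then obtain k where "a - k *s y n \<in> D" unfolding L_def by blast
    then have "(a - k *s y n) + (b - k *s x n) \<in> S"
      using ab x(1)[of n] V unfolding S_def by (blast intro: subspace_diff subspace_scale)
    then have "z - k *s u n \<in> S" by (simp add: ab y_def algebra_simps)
    then show "\<exists>n k. z - k *s u n \<in> S" by blast
  next
    assume "\<exists>n k. z - k *s u n \<in> S"
    then obtain n k a b where ab: "a \<in> D" "b \<in> V" "z - k *s u n = a + b"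
      unfolding S_def by blast
    have "z = a + b + k *s u n" using ab(3) by (metis diff_add_cancel)
    then have "z = (a + k *s y n) + (b + k *s x n)"
      by (simp add: y_def algebra_simps)
    moreover have "a + k *s y n \<in> D'"
      using sub DD' ab(1) y_L by (intro subspace_add subspace_scale) (auto simp: D'_def)
    moreover have "b + k *s x n \<in> V"
      using V ab x by (intro subspace_add subspace_scale) auto
    ultimately show "z \<in> {x + y |x y. x \<in> D' \<and> y \<in> V}" by blast
  qed
  have "D' \<inter> V = K"
  proof
    show "K \<subseteq> D' \<inter> V" using DV DD' by blast
    show "D' \<inter> V \<subseteq> K"
    proof
      fix z assume "z \<in> D' \<inter> V"
      then obtain n k where z: "z \<in> V" "z - k *s y n \<in> D" unfolding D'_def L_def by blast
      have zS: "z \<in> S" "z - k *s y n \<in> S" "x n \<in> S"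
        using z x(1)[of n] DS VS by auto
      have "z - (z - k *s y n) + k *s x n \<in> S"
        by (intro subspace_add[OF S(1)] subspace_diff[OF S(1)] subspace_scale[OF S(1)] zS)
      then have "k *s u n \<in> S" by (simp add: y_def algebra_simps)
      \<comment> \<open>In the torsion-free quotient by \<open>S\<close> the nonzero class of
        \<open>u n\<close> has infinite order. Hence an element of \<open>V\<close> in the new
        subgroup already lies in \<open>D\<close>.\<close>
      then have "k = 0" using S(2) u_notin unfolding pure_in_def by blast
      with z DV show "z \<in> K" by auto
    qed
  qed
  moreover have "pure_in {x + y |x y. x \<in> D' \<and> y \<in> V}"
    unfolding pure_in_def sums_iff
  proof (intro allI impI)
    fix m :: int and z assume m: "m \<noteq> 0" and "\<exists>n k. m *s z - k *s u n \<in> S"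
    then obtain n k where "(fact n :: int) *s (m *s z) - k *s w \<in> S" using u by metis
    then have zn: "(fact n * m) *s z - k *s w \<in> S" by simp
    \<comment> \<open>The relation has denominator \<open>fact n * m\<close>. As it divides
      \<open>fact N\<close>, the element \<open>z\<close> appears at stage \<open>N\<close> of the
      chain.\<close>
    define N where "N = nat \<bar>fact n * m\<bar>"
    have "N \<ge> 1" using m unfolding N_def by (simp add: Suc_le_eq)
    then have "N dvd fact N" by (rule dvd_fact) simp
    then have "int N dvd fact N" by (metis of_nat_dvd_iff of_nat_fact)
    then have "fact n * m dvd (fact N :: int)" by (simp add: N_def)
    then obtain c where c: "(fact N :: int) = c * (fact n * m)" by (metis dvdE mult.commute)
    have "c *s ((fact n * m) *s z - k *s w) \<in> S"
      using zn by (rule subspace_scale[OF S(1)])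
    then have "(fact N :: int) *s z - (c * k) *s w \<in> S"
      by (simp add: c scale_right_diff_distrib)
    then show "\<exists>n k. z - k *s u n \<in> S" using u by metis
  qed
  moreover have "w \<in> {x + y |x y. x \<in> D' \<and> y \<in> V}"
  proof -
    have "(fact 0 :: int) *s w - 1 *s w \<in> S" using S by (simp add: subspace_0)
    then show ?thesis unfolding sums_iff using u by metis
  qed
  ultimately show thesis using that sub DD' by blast
qed

text \<open>In other words, the extension of the torsion-free group \<open>X/V\<close> by the cotorsion group \<open>V/K\<close>
  splits.\<close>

lemma pure_cotorsion_complement:
  assumes V: "subspace V" "pure_in V" and K: "subspace K" "K \<subseteq> V"
    and solvable: "\<And>(a :: nat \<Rightarrow> 'b) q. (\<And>n. a n \<in> V) \<Longrightarrow>
      \<exists>x. \<forall>n. x n \<in> V \<and> x n - q n *s x (Suc n) - a n \<in> K"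
  obtains D where "subspace D" "D \<inter> V = K" "\<And>z. \<exists>d\<in>D. \<exists>v\<in>V. z = d + v"
proof -
  define sums where "sums D = {x + y |x y. x \<in> D \<and> y \<in> V}" for D
  \<comment> \<open>The partial complements for Zorn's lemma. Purity of \<open>sums D\<close> is
    carried along because \<open>extend_partial_complement\<close> requires it. The collection
    contains \<open>K\<close>, as \<open>K + V = V\<close>.\<close>
  define \<A> where "\<A> = {D. subspace D \<and> D \<inter> V = K \<and> pure_in (sums D)}"
  have "sums K = V"
  proof
    show "sums K \<subseteq> V"
      using K(2) subspace_add[OF V(1)] unfolding sums_def by blast
    show "V \<subseteq> sums K"
      using subspace_0[OF K(1)] unfolding sums_def by (auto intro: exI[of _ 0])
  qed
  then have "K \<in> \<A>" using V K by (auto simp: \<A>_def)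
  moreover have "\<Union>\<C> \<in> \<A>" if ne: "\<C> \<noteq> {}" and chain: "subset.chain \<A> \<C>" for \<C>
  proof -
    have \<C>: "\<And>D. D \<in> \<C> \<Longrightarrow> subspace D \<and> D \<inter> V = K \<and> pure_in (sums D)"
      and total: "\<And>D E. D \<in> \<C> \<Longrightarrow> E \<in> \<C> \<Longrightarrow> D \<subseteq> E \<or> E \<subseteq> D"
      using chain by (auto simp: subset_chain_def \<A>_def)
    have "subspace (\<Union>\<C>)"
    proof (rule subspaceI)
      show "0 \<in> \<Union>\<C>" using ne \<C> subspace_0 by auto
      show "c *s x \<in> \<Union>\<C>" if "x \<in> \<Union>\<C>" for c x using that \<C> subspace_scale by (metis UnionE UnionI)
      show "x + y \<in> \<Union>\<C>" if xy: "x \<in> \<Union>\<C>" "y \<in> \<Union>\<C>" for x y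
      proof -
        obtain D E where DE: "x \<in> D" "y \<in> E" "D \<in> \<C>" "E \<in> \<C>" using xy by blast
        have "D \<union> E \<in> \<C>"
          using total[OF DE(3,4)] DE(3,4) by (auto simp: Un_absorb1 Un_absorb2)
        moreover from this have "subspace (D \<union> E)" using \<C> by blast
        then have "x + y \<in> D \<union> E" using DE by (intro subspace_add) auto
        ultimately show ?thesis by blast
      qed
    qed
    moreover have "\<Union>\<C> \<inter> V = K" using ne \<C> by blast
    moreover have "pure_in (sums (\<Union>\<C>))"
    proof -
      have "sums (\<Union>\<C>) = (\<Union>D\<in>\<C>. sums D)" unfolding sums_def by blast
      moreover have "pure_in (sums D)" if "D \<in> \<C>" for D using \<C> that by blast
      ultimately show ?thesis unfolding pure_in_def by (metis UN_iff)
    qed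
    ultimately show ?thesis by (simp add: \<A>_def)
  qed
  ultimately have "\<exists>D\<in>\<A>. \<forall>E\<in>\<A>. D \<subseteq> E \<longrightarrow> E = D"
    by (intro subset_Zorn_nonempty) auto
  then obtain D where D: "D \<in> \<A>" and max: "\<And>E. E \<in> \<A> \<Longrightarrow> D \<subseteq> E \<Longrightarrow> E = D"
    by blast
  have D': "subspace D" "D \<inter> V = K" "pure_in (sums D)" using D by (auto simp: \<A>_def)
  have "z \<in> sums D" for z
  proof (rule ccontr)
    assume "z \<notin> sums D"
    then have "z \<notin> {x + y |x y. x \<in> D \<and> y \<in> V}"
      by (simp only: sums_def not_False_eq_True)
    from extend_partial_complement[OF V(1) D'(1,2) D'(3)[unfolded sums_def] solvable this]
    obtain E where "subspace E" "D \<subseteq> E" "E \<inter> V = K"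
      "pure_in {x + y |x y. x \<in> E \<and> y \<in> V}" "z \<in> {x + y |x y. x \<in> E \<and> y \<in> V}"
      by blast
    then have "E \<in> \<A>" "D \<subseteq> E" "z \<in> sums E"
      by (simp_all only: \<A>_def sums_def mem_Collect_eq)
    with max \<open>z \<notin> sums D\<close> show False by blast
  qed
  then have "\<exists>d\<in>D. \<exists>v\<in>V. z = d + v" for z
    unfolding sums_def by blast
  with D'(1,2) show thesis
    by (rule that)
qed

end


section \<open>Nonprincipal ultrafilters, and equations in images of ultraproducts\<close>

text \<open>Otherwise the singleton of \<open>x\<close> would belong to \<open>U\<close>. By
  properness every member of \<open>U\<close> would then contain \<open>x\<close>, making
  \<open>U\<close> principal.\<close>

lemma nonprincipal_ultrafilter_eventually_neq:
  assumes "nonprincipal_ultrafilter U"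
  shows "eventually (\<lambda>i. i \<noteq> x) U"
proof (rule ccontr)
  assume "\<not> eventually (\<lambda>i. i \<noteq> x) U"
  then have x: "eventually (\<lambda>i. i = x) U"
    using assms unfolding nonprincipal_ultrafilter_def is_ultrafilter_def
    by (auto dest: spec[of _ "\<lambda>i. i \<noteq> x"])
  have "U = principal {x}"
  proof (rule antisym)
    show "U \<le> principal {x}"
      using x by (simp add: le_principal)
    show "principal {x} \<le> U"
      unfolding le_filter_def eventually_principal
    proof (intro allI impI)
      fix P assume "eventually P U"
      with x have "eventually (\<lambda>i. P x) U"
        by eventually_elim simp
      then show "\<forall>i\<in>{x}. P i"
        using assms by (auto simp: nonprincipal_ultrafilter_def is_ultrafilter_def eventually_const)
    qed
  qed
  then show False
    using assms by (simp add: nonprincipal_ultrafilter_def)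
qed

text \<open>This allows the \<open>n\<close>-th equation of a system to fail at the finitely many
  indices below \<open>n\<close>.\<close>

lemma nonprincipal_ultrafilter_eventually_ge:
  fixes U :: "nat filter"
  assumes "nonprincipal_ultrafilter U"
  shows "eventually (\<lambda>i. n \<le> i) U"
proof (induction n)
  case (Suc n)
  then show ?case
    using nonprincipal_ultrafilter_eventually_neq[OF assms, of n] by eventually_elim simp
qed simp

lemma ultra_kernel_rcoset_eq:
  assumes G: "\<And>i. group (G i)"
    and x: "x \<in> carrier (product_group UNIV G)" and y: "y \<in> carrier (product_group UNIV G)"
    and ev: "eventually (\<lambda>i. x i = y i) U"
  shows "ultra_kernel U G #>\<^bsub>product_group UNIV G\<^esub> x = ultra_kernel U G #>\<^bsub>product_group UNIV G\<^esub> y"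
proof -
  interpret P: group "product_group UNIV G"
    using G by simp
  have sub: "subgroup (ultra_kernel U G) (product_group UNIV G)"
    using normal_ultra_kernel[OF G] by (rule normal_imp_subgroup)
  have "eventually (\<lambda>i. y i \<otimes>\<^bsub>G i\<^esub> inv\<^bsub>G i\<^esub> x i = \<one>\<^bsub>G i\<^esub>) U"
    using ev
  proof eventually_elim
    case (elim i)
    then show ?case
      using y G[of i] by (auto simp: PiE_iff group.r_inv)
  qed
  then have "y \<otimes>\<^bsub>product_group UNIV G\<^esub> inv\<^bsub>product_group UNIV G\<^esub> x \<in> ultra_kernel U G"
    using P.m_closed[OF y P.inv_closed[OF x]] x G by (simp add: ultra_kernel_def)
  then show ?thesis
    using P.repr_independence[OF subgroup.rcos_module_rev[OF sub P.group_axioms x y] x sub] by simp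
qed

text \<open>Back-substitution: \<open>m\<close> counts the equations still to be solved, beginning
  with equation \<open>n\<close>. The recursion descends in \<open>m\<close> while the equation
  index rises, and the unknown after the last equation is set to the identity.\<close>

primrec truncated_solution ::
  "('g, 'n) monoid_scheme \<Rightarrow> (nat \<Rightarrow> 'g) \<Rightarrow> (nat \<Rightarrow> int) \<Rightarrow> nat \<Rightarrow> nat \<Rightarrow> 'g" where
  "truncated_solution G g q 0 n = \<one>\<^bsub>G\<^esub>"
| "truncated_solution G g q (Suc m) n =
     g n \<otimes>\<^bsub>G\<^esub> (truncated_solution G g q m (Suc n) [^]\<^bsub>G\<^esub> q n)"

lemma truncated_solution_closed:
  assumes "group G" "\<And>n. g n \<in> carrier G"
  shows "truncated_solution G g q m n \<in> carrier G"
proof -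
  interpret group G by fact
  show ?thesis
    using assms by (induction m arbitrary: n) simp_all
qed

text \<open>Back-substitution only multiplies and takes powers, so it works in nonabelian groups.
  The truncated solutions violate equation \<open>n\<close> at most at indices \<open>i < n\<close>,
  which the ultrafilter ignores, and homomorphisms preserve solutions.\<close>

lemma image_of_ultraproduct_solvable:
  fixes U :: "nat filter" and q :: "nat \<Rightarrow> int"
  assumes A: "group A" and U: "nonprincipal_ultrafilter U" and G: "\<And>i. group (G i)"
    and image: "homomorphic_image_of A (ultraproduct U G)"
    and a: "\<And>n. a n \<in> carrier A"
  shows "\<exists>x. \<forall>n. x n \<in> carrier A \<and> x n = a n \<otimes>\<^bsub>A\<^esub> (x (Suc n) [^]\<^bsub>A\<^esub> q n)"
proof -
  define P where "P = product_group UNIV G"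
  define N where "N = ultra_kernel U G"
  interpret P: group P
    using G by (simp add: P_def)
  interpret N: normal N P
    unfolding N_def P_def by (rule normal_ultra_kernel[OF G])
  obtain h where "h \<in> epi (P Mod N) A"
    using image by (auto simp: homomorphic_image_of_def ultraproduct_def P_def N_def)
  then have h: "h \<in> hom (P Mod N) A" "h ` carrier (P Mod N) = carrier A"
    by (simp_all add: epi_def)
  define H where "H x = h (N #>\<^bsub>P\<^esub> x)" for x
  have "(h \<circ> (\<lambda>x. N #>\<^bsub>P\<^esub> x)) \<in> hom P A"
    using N.r_coset_hom_Mod h(1) by (rule hom_compose)
  then have H: "H \<in> hom P A"
    by (simp add: H_def [abs_def] comp_def)
  have "\<exists>g. g \<in> carrier P \<and> H g = a n" for n
  proof -
    have "a n \<in> h ` carrier (P Mod N)"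
      using a h(2) by simp
    then show ?thesis
      by (auto simp: H_def FactGroup_def RCOSETS_def)
  qed
  then obtain g where g: "\<And>n. g n \<in> carrier P" "\<And>n. H (g n) = a n"
    by metis
  have g_closed: "g n i \<in> carrier (G i)" for n i
    using g(1)[of n] by (auto simp: P_def)
  \<comment> \<open>In \<open>G i\<close> the equations \<open>0\<close> to \<open>i\<close> are
    solved, of which \<open>Suc i - n\<close> remain from \<open>n\<close> on. For
    \<open>n > i\<close> the truncated subtraction gives \<open>0\<close> and hence the
    identity.\<close>
  define y where "y n = (\<lambda>i. truncated_solution (G i) (\<lambda>n. g n i) q (Suc i - n) n)" for n
  have y: "y n \<in> carrier P" for n
    by (auto simp: P_def y_def PiE_iff intro: truncated_solution_closed[OF G g_closed])
  have H_y: "H (y n) = H (g n \<otimes>\<^bsub>P\<^esub> (y (Suc n) [^]\<^bsub>P\<^esub> q n))" for n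
  proof -
    have pow: "(y (Suc n) [^]\<^bsub>P\<^esub> q n) i = y (Suc n) i [^]\<^bsub>G i\<^esub> q n" for i
    proof (rule hom_int_pow[of "\<lambda>x. x i"])
      show "(\<lambda>x. x i) \<in> hom P (G i)"
        by (auto simp: P_def hom_def)
    qed (use y G P.group_axioms in auto)
    have "eventually (\<lambda>i. y n i = (g n \<otimes>\<^bsub>P\<^esub> (y (Suc n) [^]\<^bsub>P\<^esub> q n)) i) U"
      using nonprincipal_ultrafilter_eventually_ge[OF U, of n]
    proof eventually_elim
      case (elim i)
      then have "y n i = g n i \<otimes>\<^bsub>G i\<^esub> (y (Suc n) [^]\<^bsub>P\<^esub> q n) i"
        unfolding pow by (simp add: y_def Suc_diff_le)
      then show ?case
        unfolding P_def by simp
    qed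
    moreover have "g n \<otimes>\<^bsub>P\<^esub> (y (Suc n) [^]\<^bsub>P\<^esub> q n) \<in> carrier P"
      by (rule P.m_closed[OF g(1) P.int_pow_closed[OF y]])
    ultimately have "N #>\<^bsub>P\<^esub> y n = N #>\<^bsub>P\<^esub> (g n \<otimes>\<^bsub>P\<^esub> (y (Suc n) [^]\<^bsub>P\<^esub> q n))"
      unfolding N_def by (intro ultra_kernel_rcoset_eq[of G, folded P_def] G y)
    then show ?thesis
      by (simp only: H_def)
  qed
  have "H (y n) = a n \<otimes>\<^bsub>A\<^esub> (H (y (Suc n)) [^]\<^bsub>A\<^esub> q n)" for n
    unfolding H_y[of n] hom_mult[OF H g(1) P.int_pow_closed[OF y]]
      hom_int_pow[OF H y P.group_axioms A] g(2) ..
  moreover have "H (y n) \<in> carrier A" for n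
    using H y by (auto simp: hom_def)
  ultimately show ?thesis
    by (intro exI[of _ "\<lambda>n. H (y n)"]) blast
qed

section \<open>Extending a map from a free abelian group to its ultrapower\<close>

text \<open>Free abelian groups are torsion-free, which is the source of the purity of the
  diagonal.\<close>

lemma frag_cmul_cancel_left:
  assumes "n \<noteq> 0" "frag_cmul n x = frag_cmul n y"
  shows "x = y"
proof (rule poly_mapping_eqI)
  fix k
  show "Poly_Mapping.lookup x k = Poly_Mapping.lookup y k"
    using arg_cong[OF assms(2), of "\<lambda>z. Poly_Mapping.lookup z k"] assms(1) by simp
qed

text \<open>A subgroup \<open>D\<close> with \<open>D + V\<close> everything and
  \<open>D \<inter> V = K\<close> identifies the power modulo \<open>D\<close> with
  \<open>V/K\<close>, a copy of \<open>A\<close>; \<open>h\<close> is the resulting projection. It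
  is defined on sequences instead of cosets, and the last property lets it descend to the
  ultrapower.\<close>

lemma hom_from_free_Abelian_power:
  fixes A :: "('a, 'm) monoid_scheme" and U :: "'i filter" and p :: "('b \<Rightarrow>\<^sub>0 int) \<Rightarrow> 'a"
  assumes A: "comm_group A" and U: "is_ultrafilter U"
    and p: "p \<in> epi (free_Abelian_group UNIV) A"
    and solvable: "\<And>a (q :: nat \<Rightarrow> int). (\<And>n. a n \<in> carrier A) \<Longrightarrow>
      \<exists>x. \<forall>n. x n \<in> carrier A \<and> x n = a n \<otimes>\<^bsub>A\<^esub> (x (Suc n) [^]\<^bsub>A\<^esub> q n)"
  obtains h where "\<And>s. h s \<in> carrier A"
    "\<And>s t. h (\<lambda>i. s i + t i) = h s \<otimes>\<^bsub>A\<^esub> h t"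
    "\<And>c. h (\<lambda>_. c) = p c"
    "\<And>s. eventually (\<lambda>i. s i = 0) U \<Longrightarrow> h s = \<one>\<^bsub>A\<^esub>"
proof -
  interpret A: comm_group A by fact
  have U_bot: "U \<noteq> bot"
    using U by (simp add: is_ultrafilter_def)
  have p_hom: "p \<in> hom (free_Abelian_group UNIV) A" and p_surj: "range p = carrier A"
    using p by (auto simp: epi_def free_Abelian_group_def)
  have p_closed [simp]: "p c \<in> carrier A" for c
    using p_surj by blast
  have p_add: "p (c + d) = p c \<otimes>\<^bsub>A\<^esub> p d" for c d
    using hom_mult[OF p_hom, of c d] by simp
  have p_scale: "p (frag_cmul n c) = p c [^]\<^bsub>A\<^esub> n" for n c
    using hom_int_pow[OF p_hom, of c n] by simp
  have p_zero: "p 0 = \<one>\<^bsub>A\<^esub>"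
    using p_scale[of 0 0] by simp
  have p_minus: "p (- c) = inv\<^bsub>A\<^esub> p c" for c
    using p_scale[of "-1" c] by (simp add: A.int_pow_neg)
  have p_diff: "p (c - d) = p c \<otimes>\<^bsub>A\<^esub> inv\<^bsub>A\<^esub> p d" for c d
    using p_add[of c "- d"] by (simp add: p_minus)
  define scale :: "int \<Rightarrow> ('i \<Rightarrow> 'b \<Rightarrow>\<^sub>0 int) \<Rightarrow> 'i \<Rightarrow> 'b \<Rightarrow>\<^sub>0 int"
    where "scale n s = (\<lambda>i. frag_cmul n (s i))" for n s
  interpret X: int_module scale
    by unfold_locales (simp_all add: scale_def fun_eq_iff frag_cmul_distrib frag_cmul_distrib2)
  \<comment> \<open>\<open>V\<close> is the preimage in the power of \<open>F\<close> of the diagonal of the ultrapower, and \<open>V/K\<close> is \<open>A\<close>.\<close>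
  define V :: "('i \<Rightarrow> 'b \<Rightarrow>\<^sub>0 int) set" where "V = {s. \<exists>c. eventually (\<lambda>i. s i = c) U}"
  define K :: "('i \<Rightarrow> 'b \<Rightarrow>\<^sub>0 int) set"
    where "K = {s. \<exists>c. eventually (\<lambda>i. s i = c) U \<and> p c = \<one>\<^bsub>A\<^esub>}"
  have V_sub: "X.subspace V"
  proof (rule X.subspaceI)
    show "0 \<in> V" by (auto simp: V_def intro: exI[of _ 0])
    show "s + t \<in> V" if st: "s \<in> V" "t \<in> V" for s t
    proof -
      obtain c d where "eventually (\<lambda>i. s i = c) U" "eventually (\<lambda>i. t i = d) U"
        using st by (auto simp: V_def)
      then have "eventually (\<lambda>i. (s + t) i = c + d) U" by eventually_elim simp
      then show ?thesis unfolding V_def by blast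
    qed
    show "scale n s \<in> V" if s: "s \<in> V" for n s
    proof -
      obtain c where "eventually (\<lambda>i. s i = c) U" using s by (auto simp: V_def)
      then have "eventually (\<lambda>i. scale n s i = frag_cmul n c) U"
        by eventually_elim (simp add: scale_def)
      then show ?thesis unfolding V_def by blast
    qed
  qed
  have K_sub: "X.subspace K"
  proof (rule X.subspaceI)
    show "0 \<in> K" by (auto simp: K_def p_zero intro: exI[of _ 0])
    show "s + t \<in> K" if st: "s \<in> K" "t \<in> K" for s t
    proof -
      obtain c d where cd: "eventually (\<lambda>i. s i = c) U" "eventually (\<lambda>i. t i = d) U"
        "p c = \<one>\<^bsub>A\<^esub>" "p d = \<one>\<^bsub>A\<^esub>"
        using st by (auto simp: K_def)
      from cd(1,2) have "eventually (\<lambda>i. (s + t) i = c + d) U" by eventually_elim simp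
      moreover have "p (c + d) = \<one>\<^bsub>A\<^esub>" using cd by (simp add: p_add)
      ultimately show ?thesis unfolding K_def by blast
    qed
    show "scale n s \<in> K" if s: "s \<in> K" for n s
    proof -
      obtain c where c: "eventually (\<lambda>i. s i = c) U" "p c = \<one>\<^bsub>A\<^esub>" using s by (auto simp: K_def)
      from c(1) have "eventually (\<lambda>i. scale n s i = frag_cmul n c) U"
        by eventually_elim (simp add: scale_def)
      moreover have "p (frag_cmul n c) = \<one>\<^bsub>A\<^esub>" using c by (simp add: p_scale)
      ultimately show ?thesis unfolding K_def by blast
    qed
  qed
  have KV: "K \<subseteq> V" unfolding K_def V_def by blast
  have const_V: "(\<lambda>_. c) \<in> V" for c by (auto simp: V_def intro: exI[of _ c])
  have const_K: "(\<lambda>_. c) \<in> K \<longleftrightarrow> p c = \<one>\<^bsub>A\<^esub>" for c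
    using U_bot by (auto simp: K_def eventually_const)
  have V_pure: "X.pure_in V"
    unfolding X.pure_in_def
  proof (intro allI impI)
    fix n :: int and s assume n: "n \<noteq> 0" and "scale n s \<in> V"
    then obtain c where c: "eventually (\<lambda>i. frag_cmul n (s i) = c) U"
      by (auto simp: V_def scale_def)
    \<comment> \<open>Properness of \<open>U\<close> provides an index at which the equation holds.
      The value \<open>s j\<close> is the eventual constant, by torsion-freeness.\<close>
    then obtain j where j: "frag_cmul n (s j) = c"
      using eventually_happens'[OF U_bot] by blast
    from c have "eventually (\<lambda>i. s i = s j) U"
    proof eventually_elim
      case (elim i)
      with j have "frag_cmul n (s i) = frag_cmul n (s j)"
        by (simp only:)
      with n show ?case
        by (rule frag_cmul_cancel_left)
    qed
    then show "s \<in> V" unfolding V_def by blast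
  qed
  \<comment> \<open>The system is solved in \<open>A\<close>, and the solution is lifted through
    \<open>p\<close> to constant sequences.\<close>
  have VK_solvable: "\<exists>x. \<forall>n. x n \<in> V \<and> x n - scale (q n) (x (Suc n)) - a n \<in> K"
    if a: "\<And>n. a n \<in> V" for a :: "nat \<Rightarrow> 'i \<Rightarrow> 'b \<Rightarrow>\<^sub>0 int" and q
  proof -
    have "\<exists>c. eventually (\<lambda>i. a n i = c) U" for n
      using a[of n] by (simp only: V_def mem_Collect_eq)
    then obtain c where c: "\<And>n. eventually (\<lambda>i. a n i = c n) U"
      by metis
    obtain z where z: "\<And>n. z n \<in> carrier A" "\<And>n. z n = p (c n) \<otimes>\<^bsub>A\<^esub> (z (Suc n) [^]\<^bsub>A\<^esub> q n)"
      using solvable[of "\<lambda>n. p (c n)" q, OF p_closed] by blast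
    have "\<exists>y. p y = z n" for n using z(1)[of n] unfolding p_surj[symmetric] by (metis imageE)
    then obtain y where y: "\<And>n. p (y n) = z n" by metis
    have "(\<lambda>_. y n) - scale (q n) (\<lambda>_. y (Suc n)) - a n \<in> K" for n
    proof -
      define d where "d = y n - frag_cmul (q n) (y (Suc n)) - c n"
      have "eventually (\<lambda>i. ((\<lambda>_. y n) - scale (q n) (\<lambda>_. y (Suc n)) - a n) i = d) U"
        using c[of n] by eventually_elim (simp add: d_def scale_def)
      moreover have "p d = \<one>\<^bsub>A\<^esub>"
      proof -
        have "p (y n) = p (c n + frag_cmul (q n) (y (Suc n)))"
          using z(2)[of n] by (simp add: p_add p_scale y)
        then have "p (y n - (c n + frag_cmul (q n) (y (Suc n)))) = \<one>\<^bsub>A\<^esub>"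
          unfolding p_diff by simp
        then show ?thesis by (simp only: d_def diff_diff_eq add.commute)
      qed
      ultimately show ?thesis unfolding K_def by blast
    qed
    with const_V show ?thesis by (intro exI[of _ "\<lambda>n _. y n"]) blast
  qed
  obtain D where D: "X.subspace D" "D \<inter> V = K" "\<And>s. \<exists>d\<in>D. \<exists>v\<in>V. s = d + v"
    using X.pure_cotorsion_complement[OF V_sub V_pure K_sub KV VK_solvable] by blast
  \<comment> \<open>Modulo \<open>D\<close> every sequence is constant: an element of
    \<open>V\<close> differs from its eventual constant by a sequence that is eventually zero, and
    such sequences lie in \<open>K\<close>.\<close>
  have ex: "\<exists>c. s - (\<lambda>_. c) \<in> D" for s
  proof -
    obtain d v where dv: "d \<in> D" "v \<in> V" "s = d + v" using D(3) by blast
    obtain c where "eventually (\<lambda>i. v i = c) U" using dv by (auto simp: V_def)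
    then have "eventually (\<lambda>i. (v - (\<lambda>_. c)) i = 0) U" by eventually_elim simp
    then have "v - (\<lambda>_. c) \<in> K" unfolding K_def using p_zero by blast
    then have "v - (\<lambda>_. c) \<in> D" using D(2) by blast
    then have "d + (v - (\<lambda>_. c)) \<in> D" by (rule X.subspace_add[OF D(1) dv(1)])
    then have "s - (\<lambda>_. c) \<in> D" unfolding dv(3) by (simp only: add_diff_eq)
    then show ?thesis ..
  qed
  have unique: "p c = p d" if cd: "s - (\<lambda>_. c) \<in> D" "s - (\<lambda>_. d) \<in> D" for s c d
  proof -
    have "(s - (\<lambda>_. d)) - (s - (\<lambda>_. c)) \<in> D"
      by (rule X.subspace_diff[OF D(1) cd(2) cd(1)])
    moreover have "(s - (\<lambda>_. d)) - (s - (\<lambda>_. c)) = (\<lambda>_. c - d)" by (simp add: fun_eq_iff)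
    ultimately have "(\<lambda>_. c - d) \<in> K" using const_V D(2) by (metis IntI)
    then have "p (c - d) = \<one>\<^bsub>A\<^esub>" by (simp add: const_K)
    then have "p ((c - d) + d) = p d" unfolding p_add by simp
    then show ?thesis by simp
  qed
  \<comment> \<open>By \<open>unique\<close>, the choice of the constant does not affect the value
    under \<open>p\<close>.\<close>
  define h where "h s = p (SOME c. s - (\<lambda>_. c) \<in> D)" for s
  have h_eq: "h s = p c" if "s - (\<lambda>_. c) \<in> D" for s c
    unfolding h_def by (rule unique[OF someI[of "\<lambda>c. s - (\<lambda>_. c) \<in> D", OF that] that])
  show thesis
  proof (rule that[of h])
    show "h s \<in> carrier A" for s by (simp add: h_def)
    show "h (\<lambda>i. s i + t i) = h s \<otimes>\<^bsub>A\<^esub> h t" for s t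
    proof -
      obtain c d where cd: "s - (\<lambda>_. c) \<in> D" "t - (\<lambda>_. d) \<in> D" using ex by metis
      then have "(s - (\<lambda>_. c)) + (t - (\<lambda>_. d)) \<in> D" by (rule X.subspace_add[OF D(1)])
      moreover have "(s - (\<lambda>_. c)) + (t - (\<lambda>_. d)) = (\<lambda>i. s i + t i) - (\<lambda>_. c + d)"
        by (simp add: fun_eq_iff)
      ultimately have "h (\<lambda>i. s i + t i) = p (c + d)" by (intro h_eq) (simp only:)
      then show ?thesis by (simp only: h_eq[OF cd(1)] h_eq[OF cd(2)] p_add)
    qed
    show "h (\<lambda>_. c) = p c" for c
      by (rule h_eq) (simp add: X.subspace_0[OF D(1)])
    show "h s = \<one>\<^bsub>A\<^esub>" if s: "eventually (\<lambda>i. s i = 0) U" for s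
    proof -
      have "s \<in> K" using s p_zero unfolding K_def by blast
      then have "s \<in> D" using D(2) by blast
      moreover have "s - (\<lambda>_. 0) = s" by (simp add: fun_eq_iff)
      ultimately have "h s = p 0" by (intro h_eq) (simp only:)
      then show ?thesis by (simp only: p_zero)
    qed
  qed
qed

section \<open>The ultrapower of a free abelian group maps onto the given group\<close>

theorem mainTheorem2:
  fixes A :: "('a, 'm) monoid_scheme"
    and U :: "nat filter"
    and G :: "nat \<Rightarrow> ('g, 'n) monoid_scheme"
  assumes "comm_group A"
    and "nonprincipal_ultrafilter U"
    and "\<And>i. group (G i)"
    and "homomorphic_image_of A (ultraproduct U G)"
  shows "\<exists>(V :: nat filter) (B :: nat \<Rightarrow> ('a \<times> nat) monoid).
           nonprincipal_ultrafilter V \<and> (\<forall>i. comm_group (B i)) \<and>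
           homomorphic_image_of A (ultraproduct V B)"
proof -
  interpret A: comm_group A by fact
  \<comment> \<open>The factor \<open>nat\<close> makes the basis infinite, so that the free group
    has the cardinality of its basis. Basis elements whose first component lies outside
    \<open>A\<close> are sent to the identity.\<close>
  obtain p :: "('a \<times> nat \<Rightarrow>\<^sub>0 int) \<Rightarrow> 'a"
    where p_hom: "p \<in> hom (free_Abelian_group UNIV) A"
      and p_of: "\<And>x. p (frag_of x) = (if fst x \<in> carrier A then fst x else \<one>\<^bsub>A\<^esub>)"
    by (rule A.free_Abelian_group_universal
        [of "\<lambda>x :: 'a \<times> nat. if fst x \<in> carrier A then fst x else \<one>\<^bsub>A\<^esub>" UNIV]) auto
  have "p c \<in> carrier A" for c
    using p_hom by (simp add: hom_def free_Abelian_group_def Pi_iff)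
  moreover have "a \<in> range p" if "a \<in> carrier A" for a
    using p_of[of "(a, 0)"] that by (metis fst_conv rangeI)
  ultimately have p: "p \<in> epi (free_Abelian_group UNIV) A"
    using p_hom by (auto simp: epi_def free_Abelian_group_def)
  obtain h where h: "\<And>s. h s \<in> carrier A"
    "\<And>s t. h (\<lambda>i. s i + t i) = h s \<otimes>\<^bsub>A\<^esub> h t"
    "\<And>c. h (\<lambda>_ :: nat. c) = p c"
    "\<And>s. eventually (\<lambda>i. s i = 0) U \<Longrightarrow> h s = \<one>\<^bsub>A\<^esub>"
    using hom_from_free_Abelian_power[OF assms(1) _ p
        image_of_ultraproduct_solvable[OF A.group_axioms assms(2-4)]] assms(2)
    unfolding nonprincipal_ultrafilter_def by blast
  \<comment> \<open>\<open>d\<close> transports the free group to the prescribed type, which has the same cardinality because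
    it is infinite.\<close>
  have "carrier (free_Abelian_group (UNIV :: ('a \<times> nat) set)) \<approx> (UNIV :: ('a \<times> nat) set)"
    by (rule eqpoll_free_Abelian_group_infinite) (simp add: finite_prod)
  then obtain d :: "'a \<times> nat \<Rightarrow> ('a \<times> nat \<Rightarrow>\<^sub>0 int)" where "bij d"
    by (auto simp: eqpoll_def free_Abelian_group_def dest: bij_betw_inv_into)
  define e where "e = inv_into UNIV d"
  have [simp]: "d (e c) = c" "e (d x) = x" for c x
    using \<open>bij d\<close> by (simp_all add: e_def bij_is_surj surj_f_inv_f bij_is_inj)
  define B :: "('a \<times> nat) monoid"
    where "B = \<lparr>carrier = UNIV, monoid.mult = (\<lambda>x y. e (d x + d y)), one = e 0\<rparr>"
  have B: "comm_group B"
  proof (rule comm_groupI)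
    fix x assume "x \<in> carrier B"
    show "\<exists>y\<in>carrier B. y \<otimes>\<^bsub>B\<^esub> x = \<one>\<^bsub>B\<^esub>"
      by (rule bexI[of _ "e (- d x)"]) (simp_all add: B_def)
  qed (simp_all add: B_def algebra_simps)
  define P where "P = product_group (UNIV :: nat set) (\<lambda>_. B)"
  define H where "H s = h (\<lambda>i. d (s i))" for s
  have P: "group P"
    using B by (simp add: P_def comm_group_def)
  have H: "H \<in> hom P A"
    using h(1,2) by (auto simp: hom_def H_def P_def B_def)
  have normal: "ultra_kernel U (\<lambda>_. B) \<lhd> P"
    unfolding P_def using B by (intro normal_ultra_kernel) (simp add: comm_group_def)
  \<comment> \<open>Eventually trivial sequences correspond to eventually zero ones, which
    \<open>h\<close> kills; hence \<open>H\<close> factors through the ultrapower.\<close>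
  have "ultra_kernel U (\<lambda>_. B) \<subseteq> kernel P A H"
  proof
    fix s assume s: "s \<in> ultra_kernel U (\<lambda>_. B)"
    then have "eventually (\<lambda>i. s i = e 0) U"
      by (simp add: ultra_kernel_def B_def)
    then have "eventually (\<lambda>i. d (s i) = 0) U"
      by eventually_elim simp
    then show "s \<in> kernel P A H"
      using s h(4) by (auto simp: kernel_def ultra_kernel_def P_def H_def)
  qed
  then obtain k where k: "k \<in> hom (P Mod ultra_kernel U (\<lambda>_. B)) A"
    "\<And>s. s \<in> carrier P \<Longrightarrow> k (ultra_kernel U (\<lambda>_. B) #>\<^bsub>P\<^esub> s) = H s"
    using group_hom.FactGroup_universal_kernel[of P A H, OF _ normal] H P A.group_axioms
    by (auto simp: group_hom_def group_hom_axioms_def)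
  have "carrier A \<subseteq> k ` carrier (P Mod ultra_kernel U (\<lambda>_. B))"
  proof
    fix a assume "a \<in> carrier A"
    then obtain c where c: "a = p c"
      using p by (auto simp: epi_def)
    \<comment> \<open>The diagonal alone already covers \<open>A\<close>, because \<open>h\<close>
      extends the surjection \<open>p\<close>.\<close>
    define s where "s = (\<lambda>_ :: nat. e c)"
    have s: "s \<in> carrier P"
      by (simp add: P_def B_def)
    then have "a = k (ultra_kernel U (\<lambda>_. B) #>\<^bsub>P\<^esub> s)"
      by (simp add: k(2) H_def s_def h(3) c)
    with s show "a \<in> k ` carrier (P Mod ultra_kernel U (\<lambda>_. B))"
      by (auto simp: FactGroup_def RCOSETS_def)
  qed
  with k(1) have "k \<in> epi (ultraproduct U (\<lambda>_. B)) A"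
    by (auto simp: epi_def ultraproduct_def P_def hom_def)
  then have "homomorphic_image_of A (ultraproduct U (\<lambda>_. B))"
    by (auto simp: homomorphic_image_of_def)
  with assms(2) B show ?thesis
    by (intro exI[of _ U] exI[of _ "\<lambda>_. B"]) simp
qed

end
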